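(* Let $p,q\ge 2$ be integers. Then there exist $n\ge \max(p,q)$ and two stable matching instances $A$ and $B$ on the same $n$ workers and $n$ firms that are $(p,q)$ such that $\mathcal{M}_A\cap\mathcal{M}_B$ is not a sublattice of $\mathcal{L}_A$.
   Context: A stable matching instance $I$ on workers $\mathcal{W}$ and firms $\mathcal{F}$ (with $|\mathcal{W}|=|\mathcal{F}|=n$) assigns to every agent a strict total order over the agents of the other side. For a perfect matching $M$, a pair $(w,f)\notin M$ is blocking under $I$ if $w$ prefers $f$ to $M(w)$ and $f$ prefers $w$ to $M(f)$; $M$ is stable under $I$ if it has no blocking pair. $\mathcal{M}_I$ is the set of stable matchings of $I$; $\mathcal{L}_I$ is the lattice on $\mathcal{M}_I$ with join $M\vee_I M'$ assigning each worker its less preferred (under $I$) partner among $M(w),M'(w)$ and meet $M\wedge_I M'$ assigning the more preferred one. A subset of $\mathcal{M}_I$ is a sublattice of $\mathcal{L}_I$ if closed under $\vee_I$ and $\wedge_I$. Two instances $A,B$ on the same agents are $(p,q)$ if there is a set of $p$ workers and a set of $q$ firms such that every agent outside these sets has the same preference list in $A$ and in $B$ (agents in these sets may change their lists, possibly not at all). *)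

theory Defs
  imports Main
begin

text \<open>
  Agents are the elements of two explicit carrier sets.  A pair \<open>(f, f')\<close> belongs to
  \<open>wpref I w\<close> iff worker \<open>w\<close> prefers \<open>f\<close> to \<open>f'\<close>; likewise for \<open>fpref\<close>.
\<close>

record ('w, 'f) sm_inst =
  workers :: "'w set"
  firms :: "'f set"
  wpref :: "'w \<Rightarrow> 'f rel"
  fpref :: "'f \<Rightarrow> 'w rel"

text \<open>
  The library predicate \<open>strict_linear_order_on\<close> does not confine the relation to the
  carrier; the inclusions below do, so that equality of relations is equality of
  preference lists.  The preferences of elements outside the carriers are irrelevant.
\<close>

definition sm_instance :: "nat \<Rightarrow> ('w, 'f) sm_inst \<Rightarrow> bool" where
  "sm_instance n I \<longleftrightarrow>
     finite (workers I) \<and> finite (firms I) \<and>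
     card (workers I) = n \<and> card (firms I) = n \<and>
     (\<forall>w\<in>workers I. wpref I w \<subseteq> firms I \<times> firms I \<and>
        strict_linear_order_on (firms I) (wpref I w)) \<and>
     (\<forall>f\<in>firms I. fpref I f \<subseteq> workers I \<times> workers I \<and>
        strict_linear_order_on (workers I) (fpref I f))"

definition perfect_matching :: "('w, 'f) sm_inst \<Rightarrow> ('w \<times> 'f) set \<Rightarrow> bool" where
  "perfect_matching I M \<longleftrightarrow>
     M \<subseteq> workers I \<times> firms I \<and>
     (\<forall>w\<in>workers I. \<exists>!f. (w, f) \<in> M) \<and>
     (\<forall>f\<in>firms I. \<exists>!w. (w, f) \<in> M)"

definition wpartner :: "('w \<times> 'f) set \<Rightarrow> 'w \<Rightarrow> 'f" where
  "wpartner M w = (THE f. (w, f) \<in> M)"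

definition fpartner :: "('w \<times> 'f) set \<Rightarrow> 'f \<Rightarrow> 'w" where
  "fpartner M f = (THE w. (w, f) \<in> M)"

definition blocking_pair :: "('w, 'f) sm_inst \<Rightarrow> ('w \<times> 'f) set \<Rightarrow> 'w \<Rightarrow> 'f \<Rightarrow> bool" where
  "blocking_pair I M w f \<longleftrightarrow>
     w \<in> workers I \<and> f \<in> firms I \<and> (w, f) \<notin> M \<and>
     (f, wpartner M w) \<in> wpref I w \<and> (w, fpartner M f) \<in> fpref I f"

definition stable_matchings :: "('w, 'f) sm_inst \<Rightarrow> ('w \<times> 'f) set set" where
  "stable_matchings I = {M. perfect_matching I M \<and> (\<nexists>w f. blocking_pair I M w f)}"

text \<open>The join moves workers to their \<^emph>\<open>less\<close> preferred partners, the meet to the more preferred ones.\<close>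

definition sm_join :: "('w, 'f) sm_inst \<Rightarrow> ('w \<times> 'f) set \<Rightarrow> ('w \<times> 'f) set \<Rightarrow> ('w \<times> 'f) set" where
  "sm_join I M M' =
     (\<lambda>w. (w, if (wpartner M w, wpartner M' w) \<in> wpref I w
               then wpartner M' w else wpartner M w)) ` workers I"

definition sm_meet :: "('w, 'f) sm_inst \<Rightarrow> ('w \<times> 'f) set \<Rightarrow> ('w \<times> 'f) set \<Rightarrow> ('w \<times> 'f) set" where
  "sm_meet I M M' =
     (\<lambda>w. (w, if (wpartner M w, wpartner M' w) \<in> wpref I w
               then wpartner M w else wpartner M' w)) ` workers I"

definition sm_sublattice :: "('w, 'f) sm_inst \<Rightarrow> ('w \<times> 'f) set set \<Rightarrow> bool" where
  "sm_sublattice I S \<longleftrightarrow>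
     S \<subseteq> stable_matchings I \<and>
     (\<forall>M\<in>S. \<forall>M'\<in>S. sm_join I M M' \<in> S \<and> sm_meet I M M' \<in> S)"

definition pq_instances :: "nat \<Rightarrow> nat \<Rightarrow> ('w, 'f) sm_inst \<Rightarrow> ('w, 'f) sm_inst \<Rightarrow> bool" where
  "pq_instances p q A B \<longleftrightarrow>
     workers A = workers B \<and> firms A = firms B \<and>
     (\<exists>P Q. P \<subseteq> workers A \<and> card P = p \<and> Q \<subseteq> firms A \<and> card Q = q \<and>
        (\<forall>w\<in>workers A - P. wpref A w = wpref B w) \<and>
        (\<forall>f\<in>firms A - Q. fpref A f = fpref B f))"

end

theory Submission imports Defs begin

text \<open>
  Only two changing workers and two changing firms are needed, in a four by four core; every
  further worker and firm \<open>i\<close> are each other's first choice.  Let \<open>M\<close> be the identity matching and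
  let \<open>M'\<close> exchange the firms of workers \<open>0\<close>, \<open>1\<close> and those of workers \<open>2\<close>, \<open>3\<close>.  Workers \<open>2\<close>, \<open>3\<close>
  always prefer \<open>M'\<close>, while workers \<open>0\<close>, \<open>1\<close> prefer \<open>M\<close> in \<open>A\<close> and \<open>M'\<close> in \<open>B\<close>, the firms having
  the opposite preferences.  The join in \<open>A\<close> therefore agrees with \<open>M'\<close> on \<open>0\<close>, \<open>1\<close> and with \<open>M\<close> on
  \<open>2\<close>, \<open>3\<close>.  In \<open>B\<close> it leaves both worker \<open>2\<close> and firm \<open>0\<close> with the worse of their two partners,
  so they block it as soon as each ranks the other between these partners.
\<close>

text \<open>Unlisted numbers follow the listed ones in increasing order, so a short list already
  fixes a strict total order on any carrier \<open>{..<n}\<close>.\<close>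

fun rank :: "nat list \<Rightarrow> nat \<Rightarrow> nat" where
  "rank [] a = a"
| "rank (x # xs) a = (if a = x then 0 else Suc (rank xs a))"

lemma rank_eq_iff: "rank xs a = rank xs b \<longleftrightarrow> a = b"
  by (induction xs) simp_all

definition pref :: "nat \<Rightarrow> nat list \<Rightarrow> nat rel" where
  "pref n xs = {(a, b). a < n \<and> b < n \<and> rank xs a < rank xs b}"

lemma pref_strict_linear_order: "strict_linear_order_on {..<n} (pref n xs)"
proof -
  have "rank xs a < rank xs b \<or> rank xs b < rank xs a" if "a \<noteq> b" for a b
    using that by (simp add: rank_eq_iff flip: nat_neq_iff)
  then show ?thesis
    by (auto simp: strict_linear_order_on_def pref_def trans_def irrefl_def total_on_def)
qed

definition inst :: "nat \<Rightarrow> (nat \<Rightarrow> nat list) \<Rightarrow> (nat \<Rightarrow> nat list) \<Rightarrow> (nat, nat) sm_inst" where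
  "inst n u v = \<lparr>workers = {..<n}, firms = {..<n},
     wpref = \<lambda>w. pref n (u w), fpref = \<lambda>f. pref n (v f)\<rparr>"

lemma inst_simps [simp]:
  "workers (inst n u v) = {..<n}" "firms (inst n u v) = {..<n}"
  "wpref (inst n u v) w = pref n (u w)" "fpref (inst n u v) f = pref n (v f)"
  by (simp_all add: inst_def)

lemma sm_instance_inst: "sm_instance n (inst n u v)"
  by (auto simp: sm_instance_def pref_strict_linear_order) (auto simp: pref_def)

definition matching :: "nat \<Rightarrow> (nat \<Rightarrow> nat) \<Rightarrow> (nat \<times> nat) set" where
  "matching n s = (\<lambda>w. (w, s w)) ` {..<n}"

lemma in_matching_iff: "(w, f) \<in> matching n s \<longleftrightarrow> w < n \<and> f = s w"
  by (auto simp: matching_def)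

lemma wpartner_matching: "w < n \<Longrightarrow> wpartner (matching n s) w = s w"
  by (simp add: wpartner_def in_matching_iff)

text \<open>For an involution the same function gives the partners of workers and of firms.\<close>

definition involution_below :: "nat \<Rightarrow> (nat \<Rightarrow> nat) \<Rightarrow> bool" where
  "involution_below n s \<longleftrightarrow> (\<forall>i<n. s i < n \<and> s (s i) = i)"

lemma fpartner_matching:
  assumes "involution_below n s" "f < n"
  shows "fpartner (matching n s) f = s f"
  unfolding fpartner_def
  by (rule the_equality) (use assms in \<open>auto simp: in_matching_iff involution_below_def\<close>)

lemma stable_matching_iff:
  assumes "involution_below n s"
  shows "matching n s \<in> stable_matchings (inst n u v) \<longleftrightarrow>
    (\<forall>w<n. \<forall>f<n. rank (u w) f < rank (u w) (s w) \<longrightarrow> rank (v f) (s f) \<le> rank (v f) w)"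
proof -
  have "perfect_matching (inst n u v) (matching n s)"
    unfolding perfect_matching_def
  proof (intro conjI ballI)
    show "matching n s \<subseteq> workers (inst n u v) \<times> firms (inst n u v)"
      using assms by (auto simp: matching_def involution_below_def)
    show "\<exists>!f. (w, f) \<in> matching n s" if "w \<in> workers (inst n u v)" for w
      using that by (simp add: in_matching_iff)
    show "\<exists>!w. (w, f) \<in> matching n s" if "f \<in> firms (inst n u v)" for f
      using that assms
      by (intro ex1I[of _ "s f"]) (auto simp: in_matching_iff involution_below_def)
  qed
  moreover have "blocking_pair (inst n u v) (matching n s) w f \<longleftrightarrow>
      w < n \<and> f < n \<and> rank (u w) f < rank (u w) (s w) \<and> rank (v f) w < rank (v f) (s f)" for w f
  proof (cases "w < n \<and> f < n")
    case True
    then have "s w < n" "s f < n"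
      using assms by (simp_all add: involution_below_def)
    with True show ?thesis
      by (auto simp: blocking_pair_def wpartner_matching fpartner_matching[OF assms]
          in_matching_iff pref_def)
  qed (auto simp: blocking_pair_def)
  ultimately show ?thesis
    by (simp add: stable_matchings_def) (meson not_le)
qed

lemma sm_join_matching:
  assumes "involution_below n s" "involution_below n t"
  shows "sm_join (inst n u v) (matching n s) (matching n t) =
    matching n (\<lambda>w. if rank (u w) (s w) < rank (u w) (t w) then t w else s w)"
  using assms unfolding sm_join_def matching_def[of n "\<lambda>w. if _ w then _ w else _ w"]
  by (intro image_cong) (auto simp: wpartner_matching pref_def involution_below_def)

text \<open>The two partners of each core agent are listed; in \<open>[3, 0, 2]\<close> firm 0
  stands between those of worker 2.\<close>

definition u_A :: "nat \<Rightarrow> nat list" where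
  "u_A = (\<lambda>i. [i])(0 := [0, 1], 1 := [1, 0], 2 := [3, 0, 2], 3 := [2, 3])"

definition v_A :: "nat \<Rightarrow> nat list" where
  "v_A = (\<lambda>i. [i])(0 := [1, 0], 1 := [0, 1], 2 := [2, 3], 3 := [3, 2])"

definition u_B :: "nat \<Rightarrow> nat list" where
  "u_B = u_A(0 := [1, 0], 1 := [0, 1])"

definition v_B :: "nat \<Rightarrow> nat list" where
  "v_B = v_A(0 := [0, 2, 1], 1 := [1, 0])"

lemmas list_defs = u_A_def v_A_def u_B_def v_B_def

definition swap01 :: "nat \<Rightarrow> nat" where
  "swap01 = id(0 := 1, 1 := 0)"

definition swap01_23 :: "nat \<Rightarrow> nat" where
  "swap01_23 = swap01(2 := 3, 3 := 2)"

lemma involutions: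
  assumes "n \<ge> 4"
  shows "involution_below n id" "involution_below n swap01" "involution_below n swap01_23"
  using assms by (auto simp: involution_below_def swap01_def swap01_23_def)

lemma core_cases:
  obtains "i = 0" | "i = 1" | "i = 2" | "i = 3" | "i \<ge> (4 :: nat)"
  by linarith

text \<open>In B every firm has its first choice. In A only workers 2 and 3 can gain: firms 2 and 3
  have their first choices, and firm 0 ranks worker 2 below its partner 0.\<close>

lemma id_stable:
  assumes "n \<ge> 4"
  shows "matching n id \<in> stable_matchings (inst n u_A v_A) \<inter> stable_matchings (inst n u_B v_B)"
  unfolding Int_iff stable_matching_iff[OF involutions(1)[OF assms]]
proof (intro conjI allI impI)
  fix w f :: nat
  assume "rank (u_A w) f < rank (u_A w) (id w)"
  then show "rank (v_A f) (id f) \<le> rank (v_A f) w"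
    by (cases w rule: core_cases) (simp_all add: list_defs split: if_split_asm)
next
  fix w f :: nat
  assume "rank (u_B w) f < rank (u_B w) (id w)"
  then show "rank (v_B f) (id f) \<le> rank (v_B f) w"
    by (cases w rule: core_cases) (simp_all add: list_defs split: if_split_asm)
qed

text \<open>In B every worker has the first choice. In A only workers 0 and 1 can gain, from firms 0
  and 1, which have their first choices.\<close>

lemma swap01_23_stable:
  assumes "n \<ge> 4"
  shows "matching n swap01_23 \<in>
    stable_matchings (inst n u_A v_A) \<inter> stable_matchings (inst n u_B v_B)"
  unfolding Int_iff stable_matching_iff[OF involutions(3)[OF assms]]
proof (intro conjI allI impI)
  fix w f :: nat
  assume "rank (u_A w) f < rank (u_A w) (swap01_23 w)"
  then show "rank (v_A f) (swap01_23 f) \<le> rank (v_A f) w"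
    by (cases w rule: core_cases)
      (simp_all add: list_defs swap01_def swap01_23_def split: if_split_asm)
next
  fix w f :: nat
  assume "rank (u_B w) f < rank (u_B w) (swap01_23 w)"
  then show "rank (v_B f) (swap01_23 f) \<le> rank (v_B f) w"
    by (cases w rule: core_cases)
      (simp_all add: list_defs swap01_def swap01_23_def split: if_split_asm)
qed

lemma join_eq_swap01:
  assumes "n \<ge> 4"
  shows "sm_join (inst n u_A v_A) (matching n id) (matching n swap01_23) = matching n swap01"
proof -
  have "(\<lambda>w. if rank (u_A w) (id w) < rank (u_A w) (swap01_23 w) then swap01_23 w else id w) = swap01"
    by (auto simp: fun_eq_iff u_A_def swap01_def swap01_23_def)
  then show ?thesis
    using assms by (simp add: sm_join_matching involutions)
qed

lemma swap01_not_stable: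
  assumes "n \<ge> 4"
  shows "matching n swap01 \<notin> stable_matchings (inst n u_B v_B)"
proof -
  \<comment> \<open>The blocking pair comes from the middle entries of \<open>[3, 0, 2]\<close> and
    \<open>[0, 2, 1]\<close>.\<close>
  have "rank (u_B 2) 0 < rank (u_B 2) (swap01 2)" "rank (v_B 0) 2 < rank (v_B 0) (swap01 0)"
    by (simp_all add: list_defs swap01_def)
  moreover have "2 < n" "0 < n"
    using assms by simp_all
  ultimately show ?thesis
    using assms by (metis stable_matching_iff involutions(2) not_le)
qed

theorem theorem10:
  fixes p q :: nat
  assumes "p \<ge> 2" and "q \<ge> 2"
  shows "\<exists>n \<ge> max p q. \<exists>A B :: (nat, nat) sm_inst.
           sm_instance n A \<and> sm_instance n B \<and> pq_instances p q A B \<and>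
           \<not> sm_sublattice A (stable_matchings A \<inter> stable_matchings B)"
proof -
  \<comment> \<open>As \<open>p\<close> and \<open>q\<close> are at least 2, the summand 2 makes
    room for the core of size 4.\<close>
  define n where "n = max p q + 2"
  have n: "n \<ge> 4" "p \<le> n" "q \<le> n" "n \<ge> max p q"
    using assms by (auto simp: n_def)
  let ?A = "inst n u_A v_A" and ?B = "inst n u_B v_B"
  have "pq_instances p q ?A ?B"
    unfolding pq_instances_def using assms n
    \<comment> \<open>Only agents 0 and 1 of each side change their lists, and both initial segments
      contain them.\<close>
    by (intro conjI exI[of _ "{..<p}"] exI[of _ "{..<q}"]) (auto simp: u_B_def v_B_def)
  moreover have "\<not> sm_sublattice ?A (stable_matchings ?A \<inter> stable_matchings ?B)"
    using id_stable[OF n(1)] swap01_23_stable[OF n(1)] join_eq_swap01[OF n(1)]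
      swap01_not_stable[OF n(1)]
    unfolding sm_sublattice_def by (metis IntD2)
  ultimately show ?thesis
    using n(4) sm_instance_inst by blast
qed

end
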